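(* Suppose $\|\hat M_n-M\|_F=O_p(r_n)$. For the node-wise and overall clustering coefficients, $$\left|\widehat{\mathrm{cl}}_i-\mathrm{cl}_i\right|=O_p(r_n)\qquad\text{and}\qquad\left|\widehat{\mathrm{cl}}-\mathrm{cl}\right|=O_p(r_n).$$
   Context: $M=(m_{ij})\in\mathbb R^{p\times p}$ is a (weighted) network adjacency matrix, $\hat M_n=(\hat m_{ij})$ an estimator of it, and $r_n\to0$ a rate sequence. The node-wise clustering coefficient of node $i$ and the overall clustering coefficient are $$\mathrm{cl}_i=\frac{\sum_{j\ne i,\,k\ne j,\,k\ne i}m_{ij}m_{ik}m_{jk}}{\sum_{j\ne i,\,k\ne j,\,k\ne i}m_{ij}m_{ik}},\qquad \mathrm{cl}=\frac{\sum_{i,\,j\ne i,\,k\ne j,\,k\ne i}m_{ij}m_{ik}m_{jk}}{\sum_{i,\,j\ne i,\,k\ne j,\,k\ne i}m_{ij}m_{ik}},$$ with denominators nonzero; $\widehat{\mathrm{cl}}_i$ and $\widehat{\mathrm{cl}}$ are obtained by replacing $m_{ij}$ with $\hat m_{ij}$. *)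

theory Defs
  imports "HOL-Probability.Probability"
begin

definition frobenius_norm :: "real ^ 'n ^ 'm \<Rightarrow> real" where
  "frobenius_norm A = sqrt (\<Sum>i\<in>UNIV. \<Sum>j\<in>UNIV. (A $ i $ j)\<^sup>2)"

lemma frobenius_norm_eq_norm: "frobenius_norm A = norm A"
  by (simp add: frobenius_norm_def norm_vec_def L2_set_def sum_nonneg)

definition clustering_num :: "real ^ 'p ^ 'p \<Rightarrow> 'p \<Rightarrow> real" where
  "clustering_num A i =
     (\<Sum>j\<in>UNIV - {i}. \<Sum>k\<in>UNIV - {i, j}. A $ i $ j * A $ i $ k * A $ j $ k)"

definition clustering_den :: "real ^ 'p ^ 'p \<Rightarrow> 'p \<Rightarrow> real" where
  "clustering_den A i =
     (\<Sum>j\<in>UNIV - {i}. \<Sum>k\<in>UNIV - {i, j}. A $ i $ j * A $ i $ k)"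

definition node_clustering :: "real ^ 'p ^ 'p \<Rightarrow> 'p \<Rightarrow> real" where
  "node_clustering A i = clustering_num A i / clustering_den A i"

definition overall_clustering :: "real ^ 'p ^ 'p \<Rightarrow> real" where
  "overall_clustering A =
     (\<Sum>i\<in>UNIV. clustering_num A i) / (\<Sum>i\<in>UNIV. clustering_den A i)"

text \<open>\<open>bigO_prob P X r\<close> is stochastic boundedness \<open>X\<^sub>n = O\<^sub>p(r\<^sub>n)\<close> under \<open>P\<close>, intended for
  positive rates \<open>r\<close>. Measurability is part of the definition because \<^const>\<open>measure\<close>
  is 0 on non-measurable sets.\<close>

definition bigO_prob ::
    "'w measure \<Rightarrow> (nat \<Rightarrow> 'w \<Rightarrow> real) \<Rightarrow> (nat \<Rightarrow> real) \<Rightarrow> bool" where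
  "bigO_prob P X r \<longleftrightarrow>
     (\<forall>n. X n \<in> borel_measurable P) \<and>
     (\<forall>\<epsilon>>0. \<exists>C>0. \<exists>N. \<forall>n\<ge>N.
        measure P {\<omega> \<in> space P. \<bar>X n \<omega>\<bar> > C * r n} < \<epsilon>)"

end

theory Submission
  imports Defs
begin

text \<open>
  This is the \<open>O\<^sub>p\<close> half of the delta method. Numerator and denominator of a clustering coefficient
  are polynomials in the entries of the matrix, so the coefficient is differentiable at every matrix
  \<open>M\<close> at which the denominator is nonzero (lemmas \<open>differentiable_node_clustering\<close> and
  \<open>differentiable_overall_clustering\<close>). Differentiability at the single point \<open>M\<close> already yields
  \<open>\<bar>f A - f M\<bar> \<le> K * norm (A - M)\<close> for all \<open>A\<close> within some distance \<open>d\<close> of \<open>M\<close>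
  (\<open>differentiable_imp_lipschitz_at_point\<close>). As \<open>r\<^sub>n \<longlonglongrightarrow> 0\<close>, an error of at most \<open>C * r\<^sub>n\<close> eventually
  stays within \<open>d\<close>, so that the estimation error of the coefficient can exceed \<open>K * C * r\<^sub>n\<close> only
  when the matrix error exceeds \<open>C * r\<^sub>n\<close> (\<open>bigO_prob_differentiable\<close>). Outside the small ball
  the estimated denominator may vanish, but for large \<open>n\<close> those outcomes belong to the exceptional event, whose
  probability is controlled by hypothesis.
\<close>

lemma differentiable_imp_lipschitz_at_point:
  fixes f :: "'a::real_normed_vector \<Rightarrow> 'b::real_normed_vector"
  assumes "f differentiable (at a)"
  obtains K d where "K > 0" "d > 0"
    "\<And>x. norm (x - a) < d \<Longrightarrow> norm (f x - f a) \<le> K * norm (x - a)"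
proof -
  obtain f' where f': "(f has_derivative f') (at a)"
    using assms by (auto simp: differentiable_def)
  then have lin: "bounded_linear f'"
    by (rule has_derivative_bounded_linear)
  obtain d where d: "d > 0"
    "\<And>x. norm (x - a) < d \<Longrightarrow> norm (f x - f a - f' (x - a)) \<le> norm (x - a)"
    using f' unfolding has_derivative_at_alt by (force dest: spec[of _ 1])
  have "norm (f x - f a) \<le> (1 + onorm f') * norm (x - a)" if "norm (x - a) < d" for x
  proof -
    have "norm (f x - f a) \<le> norm (f x - f a - f' (x - a)) + norm (f' (x - a))"
      using norm_triangle_ineq[of "f x - f a - f' (x - a)" "f' (x - a)"] by simp
    also have "\<dots> \<le> norm (x - a) + onorm f' * norm (x - a)"
      by (intro add_mono d(2) that onorm lin)
    finally show ?thesis by (simp add: algebra_simps)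
  qed
  moreover have "1 + onorm f' > 0"
    using onorm_pos_le[OF lin] by linarith
  ultimately show thesis using that d(1) by blast
qed

text \<open>
  Differentiability bounds \<open>f\<close> only near \<open>a\<close>, but this covers all outcomes that matter: outside the
  event \<open>{norm (X n - a) > C * r n}\<close> the argument is so close to \<open>a\<close>, for large \<open>n\<close>, that the linear
  bound applies. The same \<open>\<epsilon>\<close> therefore serves for \<open>X\<close> and for \<open>f \<circ> X\<close>, and only the constant
  changes, from \<open>C\<close> to \<open>K * C\<close>. Measurability of \<open>f\<close> on the whole space makes \<open>f \<circ> X n\<close> a
  random variable, which differentiability at one point cannot provide.
\<close>

lemma bigO_prob_differentiable:
  fixes X :: "nat \<Rightarrow> 'w \<Rightarrow> 'a::{real_normed_vector, second_countable_topology}" and f :: "'a \<Rightarrow> real"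
  assumes "finite_measure P"
    and X: "\<And>n. X n \<in> borel_measurable P"
    and f: "f \<in> borel_measurable borel"
    and diff: "f differentiable (at a)"
    and lim: "r \<longlonglongrightarrow> 0"
    and bigO: "bigO_prob P (\<lambda>n \<omega>. norm (X n \<omega> - a)) r"
  shows "bigO_prob P (\<lambda>n \<omega>. \<bar>f (X n \<omega>) - f a\<bar>) r"
  unfolding bigO_prob_def
proof (intro conjI allI impI)
  interpret finite_measure P by fact
  note [measurable] = X f
  show "(\<lambda>\<omega>. \<bar>f (X n \<omega>) - f a\<bar>) \<in> borel_measurable P" for n
    by measurable
  fix \<epsilon> :: real assume "\<epsilon> > 0"
  obtain K d where K: "K > 0" and d: "d > 0"
    and lip: "\<And>x. norm (x - a) < d \<Longrightarrow> norm (f x - f a) \<le> K * norm (x - a)"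
    using differentiable_imp_lipschitz_at_point[OF diff] by blast
  obtain C N where C: "C > 0"
    and N: "\<And>n. n \<ge> N \<Longrightarrow> measure P {\<omega> \<in> space P. norm (X n \<omega> - a) > C * r n} < \<epsilon>"
    using bigO \<open>\<epsilon> > 0\<close> unfolding bigO_prob_def abs_norm_cancel by blast
  have "(\<lambda>n. C * r n) \<longlonglongrightarrow> 0"
    using tendsto_mult_right_zero[OF lim] .
  then have "\<forall>\<^sub>F n in sequentially. C * r n < d"
    using d by (rule order_tendstoD(2))
  then obtain N' where N': "\<And>n. n \<ge> N' \<Longrightarrow> C * r n < d"
    unfolding eventually_sequentially by blast
  have "measure P {\<omega> \<in> space P. \<bar>\<bar>f (X n \<omega>) - f a\<bar>\<bar> > K * C * r n} < \<epsilon>"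
    if n: "n \<ge> max N N'" for n
  proof -
    have "\<bar>f (X n \<omega>) - f a\<bar> \<le> K * C * r n" if "norm (X n \<omega> - a) \<le> C * r n" for \<omega>
    proof -
      have "norm (X n \<omega> - a) < d"
        using that N'[of n] n by simp
      then have "\<bar>f (X n \<omega>) - f a\<bar> \<le> K * norm (X n \<omega> - a)"
        using lip by force
      also have "\<dots> \<le> K * (C * r n)"
        using that K by simp
      finally show ?thesis by (simp add: mult.assoc)
    qed
    then have "{\<omega> \<in> space P. \<bar>\<bar>f (X n \<omega>) - f a\<bar>\<bar> > K * C * r n}
        \<subseteq> {\<omega> \<in> space P. norm (X n \<omega> - a) > C * r n}"
      by (force simp: not_le[symmetric])
    then have "measure P {\<omega> \<in> space P. \<bar>\<bar>f (X n \<omega>) - f a\<bar>\<bar> > K * C * r n}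
        \<le> measure P {\<omega> \<in> space P. norm (X n \<omega> - a) > C * r n}"
      by (rule finite_measure_mono) measurable
    with N[of n] n show ?thesis by simp
  qed
  then show "\<exists>C>0. \<exists>N. \<forall>n\<ge>N. measure P {\<omega> \<in> space P. \<bar>\<bar>f (X n \<omega>) - f a\<bar>\<bar> > C * r n} < \<epsilon>"
    using K C by (meson mult_pos_pos)
qed

lemma differentiable_entry: "(\<lambda>A :: real ^ 'n ^ 'm. A $ i $ j) differentiable (at M within S)"
  by (intro bounded_linear_imp_differentiable
      bounded_linear_compose[OF bounded_linear_vec_nth bounded_linear_vec_nth])

lemma differentiable_clustering_num: "(\<lambda>A. clustering_num A i) differentiable (at M within S)"
  unfolding clustering_num_def
  by (intro differentiable_sum differentiable_mult ballI finite differentiable_entry)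

lemma differentiable_clustering_den: "(\<lambda>A. clustering_den A i) differentiable (at M within S)"
  unfolding clustering_den_def
  by (intro differentiable_sum differentiable_mult ballI finite differentiable_entry)

lemma differentiable_node_clustering:
  assumes "clustering_den M i \<noteq> 0"
  shows "(\<lambda>A. node_clustering A i) differentiable (at M)"
  unfolding node_clustering_def using assms
  by (intro differentiable_divide differentiable_clustering_num differentiable_clustering_den)

lemma differentiable_overall_clustering:
  assumes "(\<Sum>i\<in>UNIV. clustering_den M i) \<noteq> 0"
  shows "overall_clustering differentiable (at M)"
  unfolding overall_clustering_def[abs_def] using assms
  by (intro differentiable_divide differentiable_sum ballI finite
      differentiable_clustering_num differentiable_clustering_den)

text \<open>
  Measurability holds on the whole space, zeros of the denominators included: the coefficients are
  quotients of continuous functions, and real division, with \<open>x / 0 = 0\<close>, is Borel measurable.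
\<close>

lemma borel_measurable_clustering_num [measurable]:
  "(\<lambda>A. clustering_num A i) \<in> borel_measurable borel"
  by (intro borel_measurable_continuous_onI differentiable_imp_continuous_on
      differentiable_at_imp_differentiable_on differentiable_clustering_num)

lemma borel_measurable_clustering_den [measurable]:
  "(\<lambda>A. clustering_den A i) \<in> borel_measurable borel"
  by (intro borel_measurable_continuous_onI differentiable_imp_continuous_on
      differentiable_at_imp_differentiable_on differentiable_clustering_den)

lemma borel_measurable_node_clustering:
  "(\<lambda>A. node_clustering A i) \<in> borel_measurable borel"
  unfolding node_clustering_def by measurable

lemma borel_measurable_overall_clustering:
  "overall_clustering \<in> borel_measurable borel"
  unfolding overall_clustering_def[abs_def] by measurable

theorem theorem8:
  fixes P :: "'w measure"
    and M :: "real ^ 'p ^ 'p"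
    and Mhat :: "nat \<Rightarrow> 'w \<Rightarrow> real ^ 'p ^ 'p"
    and r :: "nat \<Rightarrow> real"
  assumes "prob_space P"
    and "\<And>n. Mhat n \<in> borel_measurable P"
    and "\<And>n. r n > 0"
    and "r \<longlonglongrightarrow> 0"
    and "bigO_prob P (\<lambda>n \<omega>. frobenius_norm (Mhat n \<omega> - M)) r"
  shows "(\<forall>i. clustering_den M i \<noteq> 0 \<longrightarrow>
            bigO_prob P (\<lambda>n \<omega>. \<bar>node_clustering (Mhat n \<omega>) i - node_clustering M i\<bar>) r)
       \<and> ((\<Sum>i\<in>UNIV. clustering_den M i) \<noteq> 0 \<longrightarrow>
            bigO_prob P (\<lambda>n \<omega>. \<bar>overall_clustering (Mhat n \<omega>) - overall_clustering M\<bar>) r)"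
proof -
  have fin: "finite_measure P"
    using assms(1) by (rule prob_space.finite_measure)
  have bigO: "bigO_prob P (\<lambda>n \<omega>. norm (Mhat n \<omega> - M)) r"
    using assms(5) by (simp add: frobenius_norm_eq_norm)
  note delta = bigO_prob_differentiable[OF fin assms(2) _ _ assms(4) bigO]
  show ?thesis
    by (intro conjI allI impI
        delta[OF borel_measurable_node_clustering differentiable_node_clustering]
        delta[OF borel_measurable_overall_clustering differentiable_overall_clustering])
qed

end
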